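(* Let $k$ be a field and let $X$ be a finite nonempty set with $|X|=n$. Then the Gelfand-Kirillov dimension of the free dendriform algebra $DD(X)$ over $k$ is $$GKDD(X)=\infty.$$
   Context: A dendriform algebra over $k$ is a $k$-vector space with bilinear operations $\prec,\succ$ satisfying, for all $x,y,z$: $(x\succ y)\prec z=x\succ(y\prec z)$; $(x\prec y)\prec z=x\prec(y\prec z)+x\prec(y\succ z)$; $x\succ(y\succ z)=(x\succ y)\succ z+(x\prec y)\succ z$. $DD(X)$ is the free dendriform algebra on $X=\{x_1,\dots,x_n\}$. For an algebra $R$ over $k$ generated by $x_1,\dots,x_n$, write $R=\bigcup_{d\in\mathbb{N}}V_{(d)}$, where $V_{(d)}$ is the subspace spanned by all monomials in the $x_i$ of length $\le d$ (for $DD(X)$: all expressions built from the $x_i$ with the operations $\prec,\succ$ having at most $d$ occurrences of generators). The Gelfand-Kirillov dimension of $R$ is $$GKR=\limsup_{d\to\infty}\frac{\log\dim_kV_{(d)}}{\log d}.$$ *)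

theory Defs
  imports Complex_Main "HOL-Library.Poly_Mapping" "HOL-Library.Extended_Real"
begin

section \<open>Dendriform algebras and their Gelfand-Kirillov dimension\<close>

locale dendriform_algebra = vector_space scale
  for scale :: "'k::field \<Rightarrow> 'a::ab_group_add \<Rightarrow> 'a" (infixr "*s" 75) +
  fixes prec :: "'a \<Rightarrow> 'a \<Rightarrow> 'a" (infixl "\<prec>" 70)
    and succ :: "'a \<Rightarrow> 'a \<Rightarrow> 'a" (infixl "\<succ>" 70)
  assumes prec_add_left: "(x + y) \<prec> z = x \<prec> z + y \<prec> z"
    and prec_add_right: "x \<prec> (y + z) = x \<prec> y + x \<prec> z"
    and prec_scale_left: "(c *s x) \<prec> y = c *s (x \<prec> y)"
    and prec_scale_right: "x \<prec> (c *s y) = c *s (x \<prec> y)"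
    and succ_add_left: "(x + y) \<succ> z = x \<succ> z + y \<succ> z"
    and succ_add_right: "x \<succ> (y + z) = x \<succ> y + x \<succ> z"
    and succ_scale_left: "(c *s x) \<succ> y = c *s (x \<succ> y)"
    and succ_scale_right: "x \<succ> (c *s y) = c *s (x \<succ> y)"
    and succ_prec: "(x \<succ> y) \<prec> z = x \<succ> (y \<prec> z)"
    and prec_prec: "(x \<prec> y) \<prec> z = x \<prec> (y \<prec> z) + x \<prec> (y \<succ> z)"
    and succ_succ: "x \<succ> (y \<succ> z) = (x \<succ> y) \<succ> z + (x \<prec> y) \<succ> z"
begin

text \<open>\<open>monomial G d u\<close>: the element \<open>u\<close> is the value of an expression built from elements of
  \<open>G\<close> with the two products, with exactly \<open>d\<close> occurrences of elements of \<open>G\<close>.\<close>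

inductive monomial :: "'a set \<Rightarrow> nat \<Rightarrow> 'a \<Rightarrow> bool" for G where
  gen: "x \<in> G \<Longrightarrow> monomial G 1 x"
| prec: "monomial G i u \<Longrightarrow> monomial G j v \<Longrightarrow> monomial G (i + j) (u \<prec> v)"
| succ: "monomial G i u \<Longrightarrow> monomial G j v \<Longrightarrow> monomial G (i + j) (u \<succ> v)"

definition V :: "'a set \<Rightarrow> nat \<Rightarrow> 'a set" where
  "V G d = span {u. \<exists>i\<le>d. monomial G i u}"

text \<open>The dimension with respect to a finite generating set \<open>G\<close>. For finite \<open>G\<close> every \<open>V G d\<close> is
  finite-dimensional, so \<open>dim\<close> is the actual dimension. The terms
  for \<open>d \<le> 1\<close>, where \<open>ln d = 0\<close>, do not affect the upper limit.\<close>

definition GK_dim :: "'a set \<Rightarrow> ereal" where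
  "GK_dim G = limsup (\<lambda>d. ereal (ln (real (dim (V G d))) / ln (real d)))"

lemma finite_monomials:
  assumes "finite G"
  shows "finite {u. \<exists>i\<le>d. monomial G i u}"
proof (induction d)
  case 0
  have "i > 0" if "monomial G i u" for i u
    using that by induction auto
  then show ?case by (auto intro: finite_subset[of _ "{}"])
next
  case (Suc d)
  let ?M = "{u. \<exists>i\<le>d. monomial G i u}"
  have pos: "i > 0" if "monomial G i u" for i u
    using that by induction auto
  have "{u. \<exists>i\<le>Suc d. monomial G i u} \<subseteq>
      G \<union> (\<lambda>(u, v). u \<prec> v) ` (?M \<times> ?M) \<union> (\<lambda>(u, v). u \<succ> v) ` (?M \<times> ?M)" (is "_ \<subseteq> ?R")
  proof (rule subsetI)
    fix u assume "u \<in> {u. \<exists>i\<le>Suc d. monomial G i u}"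
    then obtain i where i: "i \<le> Suc d" and "monomial G i u" by blast
    from this(2) show "u \<in> ?R"
    proof cases
      case gen
      then show ?thesis by simp
    next
      case (prec i1 u1 j1 v1)
      have "i1 \<le> d" "j1 \<le> d"
        using i prec(1) pos[OF prec(3)] pos[OF prec(4)] by auto
      then have "(u1, v1) \<in> ?M \<times> ?M" using prec by auto
      then show ?thesis unfolding prec(2) by (intro UnI1 UnI2 image_eqI[of _ _ "(u1, v1)"]) auto
    next
      case (succ i1 u1 j1 v1)
      have "i1 \<le> d" "j1 \<le> d"
        using i succ(1) pos[OF succ(3)] pos[OF succ(4)] by auto
      then have "(u1, v1) \<in> ?M \<times> ?M" using succ by auto
      then show ?thesis unfolding succ(2) by (intro UnI2 image_eqI[of _ _ "(u1, v1)"]) auto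
    qed
  qed
  moreover have "finite ?R"
    using Suc.IH assms by (intro finite_UnI finite_imageI finite_cartesian_product)
  ultimately show ?case by (rule finite_subset)
qed

end


section \<open>The free dendriform algebra\<close>

text \<open>The non-associative words in two binary operations; the vector space with this basis,
  \<open>'x dword \<Rightarrow>\<^sub>0 'k\<close>, is the free algebra with two bilinear products.\<close>

datatype 'x dword = Gen 'x | Prec "'x dword" "'x dword" | Succ "'x dword" "'x dword"

definition smult :: "'k \<Rightarrow> ('b \<Rightarrow>\<^sub>0 'k) \<Rightarrow> ('b \<Rightarrow>\<^sub>0 'k::field)" where
  "smult c f = Poly_Mapping.map ((*) c) f"

definition bilin :: "('b \<Rightarrow> 'b \<Rightarrow> 'b) \<Rightarrow> ('b \<Rightarrow>\<^sub>0 'k::field) \<Rightarrow> ('b \<Rightarrow>\<^sub>0 'k) \<Rightarrow> ('b \<Rightarrow>\<^sub>0 'k)" where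
  "bilin m f g = (\<Sum>s\<in>Poly_Mapping.keys f. \<Sum>t\<in>Poly_Mapping.keys g.
    Poly_Mapping.single (m s t) (Poly_Mapping.lookup f s * Poly_Mapping.lookup g t))"

text \<open>The smallest congruence whose quotient is a dendriform algebra, i.e. congruence modulo the
  ideal generated by the three dendriform relations.\<close>

inductive dcong :: "('x dword \<Rightarrow>\<^sub>0 'k::field) \<Rightarrow> ('x dword \<Rightarrow>\<^sub>0 'k) \<Rightarrow> bool" where
  refl: "dcong f f"
| sym: "dcong f g \<Longrightarrow> dcong g f"
| trans: "dcong f g \<Longrightarrow> dcong g h \<Longrightarrow> dcong f h"
| add: "dcong f f' \<Longrightarrow> dcong g g' \<Longrightarrow> dcong (f + g) (f' + g')"
| smult: "dcong f f' \<Longrightarrow> dcong (smult c f) (smult c f')"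
| prec: "dcong f f' \<Longrightarrow> dcong g g' \<Longrightarrow> dcong (bilin Prec f g) (bilin Prec f' g')"
| succ: "dcong f f' \<Longrightarrow> dcong g g' \<Longrightarrow> dcong (bilin Succ f g) (bilin Succ f' g')"
| succ_prec: "dcong (bilin Prec (bilin Succ f g) h) (bilin Succ f (bilin Prec g h))"
| prec_prec: "dcong (bilin Prec (bilin Prec f g) h)
    (bilin Prec f (bilin Prec g h) + bilin Prec f (bilin Succ g h))"
| succ_succ: "dcong (bilin Succ f (bilin Succ g h))
    (bilin Succ (bilin Succ f g) h + bilin Succ (bilin Prec f g) h)"

quotient_type (overloaded) ('x, 'k) DD = "'x dword \<Rightarrow>\<^sub>0 'k::field" / dcong
  by (rule equivpI) (auto intro!: reflpI sympI transpI intro: dcong.intros)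

lemma lookup_smult [simp]: "Poly_Mapping.lookup (smult c f) s = c * Poly_Mapping.lookup f s"
  unfolding smult_def by (simp add: map.rep_eq when_def)

lemma smult_minus: "smult (- 1) f = - f"
  by (rule poly_mapping_eqI) simp

instantiation DD :: (type, field) ab_group_add
begin

lift_definition zero_DD :: "('a, 'b) DD" is 0 .
lift_definition plus_DD :: "('a, 'b) DD \<Rightarrow> ('a, 'b) DD \<Rightarrow> ('a, 'b) DD" is "(+)"
  by (rule dcong.add)
lift_definition uminus_DD :: "('a, 'b) DD \<Rightarrow> ('a, 'b) DD" is uminus
  using dcong.smult[of _ _ "- 1"] by (simp add: smult_minus)
lift_definition minus_DD :: "('a, 'b) DD \<Rightarrow> ('a, 'b) DD \<Rightarrow> ('a, 'b) DD" is "(-)"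
  using dcong.add[OF _ dcong.smult[of _ _ "- 1"]] by (simp add: smult_minus)

instance
  by (intro_classes; transfer) (auto simp: algebra_simps intro: dcong.refl)

end

lift_definition DD_scale :: "'k \<Rightarrow> ('x, 'k::field) DD \<Rightarrow> ('x, 'k) DD" is smult
  by (rule dcong.smult)
lift_definition DD_prec :: "('x, 'k::field) DD \<Rightarrow> ('x, 'k) DD \<Rightarrow> ('x, 'k) DD" is "bilin Prec"
  by (rule dcong.prec)
lift_definition DD_succ :: "('x, 'k::field) DD \<Rightarrow> ('x, 'k) DD \<Rightarrow> ('x, 'k) DD" is "bilin Succ"
  by (rule dcong.succ)
lift_definition DD_gen :: "'x \<Rightarrow> ('x, 'k::field) DD" is "\<lambda>x. Poly_Mapping.single (Gen x) 1" .

lemma bilin_superset: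
  assumes "finite S" "Poly_Mapping.keys f \<subseteq> S" "finite T" "Poly_Mapping.keys g \<subseteq> T"
  shows "bilin m f g = (\<Sum>s\<in>S. \<Sum>t\<in>T.
    Poly_Mapping.single (m s t) (Poly_Mapping.lookup f s * Poly_Mapping.lookup g t))"
proof -
  have "bilin m f g = (\<Sum>s\<in>Poly_Mapping.keys f. \<Sum>t\<in>T.
    Poly_Mapping.single (m s t) (Poly_Mapping.lookup f s * Poly_Mapping.lookup g t))"
    unfolding bilin_def using assms
    by (intro sum.cong refl sum.mono_neutral_left) (auto simp: in_keys_iff)
  also have "\<dots> = (\<Sum>s\<in>S. \<Sum>t\<in>T.
    Poly_Mapping.single (m s t) (Poly_Mapping.lookup f s * Poly_Mapping.lookup g t))"
    using assms by (intro sum.mono_neutral_left) (auto simp: in_keys_iff)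
  finally show ?thesis .
qed

lemma keys_smult: "Poly_Mapping.keys (smult c f) \<subseteq> Poly_Mapping.keys f"
  by (auto simp: in_keys_iff)

lemma bilin_add_left: "bilin m (f + g) h = bilin m f h + bilin m g h"
proof -
  let ?S = "Poly_Mapping.keys f \<union> Poly_Mapping.keys g"
  have "Poly_Mapping.keys (f + g) \<subseteq> ?S" by (rule Poly_Mapping.keys_add)
  then show ?thesis
    using bilin_superset[of ?S f "Poly_Mapping.keys h" h]
      bilin_superset[of ?S g "Poly_Mapping.keys h" h]
      bilin_superset[of ?S "f + g" "Poly_Mapping.keys h" h]
    by (simp add: lookup_add distrib_right single_add sum.distrib)
qed

lemma bilin_add_right: "bilin m h (f + g) = bilin m h f + bilin m h g"
proof -
  let ?S = "Poly_Mapping.keys f \<union> Poly_Mapping.keys g"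
  have "Poly_Mapping.keys (f + g) \<subseteq> ?S" by (rule Poly_Mapping.keys_add)
  then show ?thesis
    using bilin_superset[of "Poly_Mapping.keys h" h ?S f]
      bilin_superset[of "Poly_Mapping.keys h" h ?S g]
      bilin_superset[of "Poly_Mapping.keys h" h ?S "f + g"]
    by (simp add: lookup_add distrib_left single_add sum.distrib)
qed

lemma smult_0_left: "smult 0 f = 0"
  and smult_0_right: "smult c 0 = 0"
  and smult_add: "smult c (f + g) = smult c f + smult c g"
  and smult_add_left: "smult (c + d) f = smult c f + smult d f"
  and smult_smult: "smult c (smult d f) = smult (c * d) f"
  and smult_one: "smult 1 f = f"
  and smult_single: "smult c (Poly_Mapping.single s a) = Poly_Mapping.single s (c * a)"
  by (rule poly_mapping_eqI; simp add: lookup_add lookup_single when_def algebra_simps)+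

lemma smult_sum: "smult c (sum F A) = (\<Sum>a\<in>A. smult c (F a))"
  by (induction A rule: infinite_finite_induct) (auto simp: smult_0_right smult_add)

lemma bilin_smult_left: "bilin m (smult c f) g = smult c (bilin m f g)"
  using bilin_superset[of "Poly_Mapping.keys f" "smult c f" "Poly_Mapping.keys g" g]
    keys_smult[of c f]
  by (simp add: bilin_def smult_sum smult_single mult.assoc)

lemma bilin_smult_right: "bilin m f (smult c g) = smult c (bilin m f g)"
  using bilin_superset[of "Poly_Mapping.keys f" f "Poly_Mapping.keys g" "smult c g"]
    keys_smult[of c g]
  by (simp add: bilin_def smult_sum smult_single mult.left_commute)

lemma dcongI: "f = g \<Longrightarrow> dcong f g"
  by (simp add: dcong.refl)

interpretation DD: dendriform_algebra
  "DD_scale :: 'k::field \<Rightarrow> ('x, 'k) DD \<Rightarrow> ('x, 'k) DD" DD_prec DD_succ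
  by (unfold_locales; transfer;
      (rule dcong.succ_prec dcong.prec_prec dcong.succ_succ
       | rule dcongI, simp add: smult_add smult_add_left smult_smult smult_one
           bilin_add_left bilin_add_right bilin_smult_left bilin_smult_right))


subsection \<open>Universal property\<close>

context dendriform_algebra
begin

primrec word_val :: "('x \<Rightarrow> 'a) \<Rightarrow> 'x dword \<Rightarrow> 'a" where
  "word_val h (Gen x) = h x"
| "word_val h (Prec s t) = word_val h s \<prec> word_val h t"
| "word_val h (Succ s t) = word_val h s \<succ> word_val h t"

definition word_ext :: "('x \<Rightarrow> 'a) \<Rightarrow> ('x dword \<Rightarrow>\<^sub>0 'k) \<Rightarrow> 'a" where
  "word_ext h f = (\<Sum>s\<in>Poly_Mapping.keys f. Poly_Mapping.lookup f s *s word_val h s)"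

lemma word_ext_superset:
  assumes "finite S" "Poly_Mapping.keys f \<subseteq> S"
  shows "word_ext h f = (\<Sum>s\<in>S. Poly_Mapping.lookup f s *s word_val h s)"
  unfolding word_ext_def using assms
  by (intro sum.mono_neutral_left) (auto simp: in_keys_iff)

lemma word_ext_add: "word_ext h (f + g) = word_ext h f + word_ext h g"
proof -
  let ?S = "Poly_Mapping.keys f \<union> Poly_Mapping.keys g"
  have "Poly_Mapping.keys (f + g) \<subseteq> ?S" by (rule Poly_Mapping.keys_add)
  then show ?thesis
    using word_ext_superset[of ?S f] word_ext_superset[of ?S g] word_ext_superset[of ?S "f + g"]
    by (simp add: lookup_add scale_left_distrib sum.distrib)
qed

lemma word_ext_smult: "word_ext h (smult c f) = c *s word_ext h f"
  using word_ext_superset[of "Poly_Mapping.keys f" "smult c f"] keys_smult[of c f]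
  by (simp add: word_ext_def scale_sum_right)

lemma word_ext_single: "word_ext h (Poly_Mapping.single s c) = c *s word_val h s"
  by (simp add: word_ext_def)

lemma word_ext_sum: "word_ext h (sum F A) = (\<Sum>a\<in>A. word_ext h (F a))"
proof (induction A rule: infinite_finite_induct)
qed (auto simp: word_ext_add, simp_all add: word_ext_def)

lemma prec_sum_left: "sum F A \<prec> y = (\<Sum>a\<in>A. F a \<prec> y)"
  using prec_scale_left[of 0 0 y]
  by (induction A rule: infinite_finite_induct) (auto simp: prec_add_left)

lemma prec_sum_right: "y \<prec> sum F A = (\<Sum>a\<in>A. y \<prec> F a)"
  using prec_scale_right[of y 0 0]
  by (induction A rule: infinite_finite_induct) (auto simp: prec_add_right)

lemma succ_sum_left: "sum F A \<succ> y = (\<Sum>a\<in>A. F a \<succ> y)"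
  using succ_scale_left[of 0 0 y]
  by (induction A rule: infinite_finite_induct) (auto simp: succ_add_left)

lemma succ_sum_right: "y \<succ> sum F A = (\<Sum>a\<in>A. y \<succ> F a)"
  using succ_scale_right[of y 0 0]
  by (induction A rule: infinite_finite_induct) (auto simp: succ_add_right)

lemma word_ext_prec: "word_ext h (bilin Prec f g) = word_ext h f \<prec> word_ext h g"
  unfolding bilin_def word_ext_sum word_ext_single word_ext_def[of h f] word_ext_def[of h g]
    prec_sum_left prec_sum_right
  by (simp add: prec_scale_left prec_scale_right, subst sum.swap, simp add: mult.commute)

lemma word_ext_succ: "word_ext h (bilin Succ f g) = word_ext h f \<succ> word_ext h g"
  unfolding bilin_def word_ext_sum word_ext_single word_ext_def[of h f] word_ext_def[of h g]
    succ_sum_left succ_sum_right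
  by (simp add: succ_scale_left succ_scale_right, subst sum.swap, simp add: mult.commute)

lemma word_ext_dcong: "dcong f g \<Longrightarrow> word_ext h f = word_ext h g"
  by (induction rule: dcong.induct)
     (simp_all add: word_ext_add word_ext_smult word_ext_prec word_ext_succ
       succ_prec prec_prec succ_succ)

end

lemma bilin_single:
  "bilin m (Poly_Mapping.single s 1) (Poly_Mapping.single t 1) = Poly_Mapping.single (m s t) 1"
  by (simp add: bilin_def)

theorem DD_universal:
  fixes scale :: "'k::field \<Rightarrow> 'a::ab_group_add \<Rightarrow> 'a" and h :: "'x \<Rightarrow> 'a"
  assumes "dendriform_algebra scale prec succ"
  shows "\<exists>!\<phi> :: ('x, 'k) DD \<Rightarrow> 'a.
    Vector_Spaces.linear DD_scale scale \<phi> \<and>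
    (\<forall>u v. \<phi> (DD_prec u v) = prec (\<phi> u) (\<phi> v)) \<and>
    (\<forall>u v. \<phi> (DD_succ u v) = succ (\<phi> u) (\<phi> v)) \<and>
    (\<forall>x. \<phi> (DD_gen x) = h x)" (is "\<exists>!\<phi>. ?P \<phi>")
proof -
  interpret A: dendriform_algebra scale prec succ by fact
  define \<phi> where "\<phi> u = A.word_ext h (rep_DD u)" for u :: "('x, 'k) DD"
  have \<phi>: "\<phi> (abs_DD f) = A.word_ext h f" for f
    unfolding \<phi>_def
    by (rule A.word_ext_dcong) (rule Quotient_rep_abs[OF Quotient_DD dcong.refl])
  have add: "\<phi> (u + v) = \<phi> u + \<phi> v" for u v
    by (induction u rule: DD.abs_induct, induction v rule: DD.abs_induct)
       (simp add: plus_DD.abs_eq \<phi> A.word_ext_add)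
  have scale: "\<phi> (DD_scale c u) = scale c (\<phi> u)" for c u
    by (induction u rule: DD.abs_induct) (simp add: DD_scale.abs_eq \<phi> A.word_ext_smult)
  have prec: "\<phi> (DD_prec u v) = prec (\<phi> u) (\<phi> v)" for u v
    by (induction u rule: DD.abs_induct, induction v rule: DD.abs_induct)
       (simp add: DD_prec.abs_eq \<phi> A.word_ext_prec)
  have succ: "\<phi> (DD_succ u v) = succ (\<phi> u) (\<phi> v)" for u v
    by (induction u rule: DD.abs_induct, induction v rule: DD.abs_induct)
       (simp add: DD_succ.abs_eq \<phi> A.word_ext_succ)
  have gen: "\<phi> (DD_gen x) = h x" for x
    by (simp add: DD_gen_def \<phi> A.word_ext_single)
  have "Vector_Spaces.linear DD_scale scale \<phi>"
    unfolding Vector_Spaces.linear_iff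
    using DD.vector_space_axioms A.vector_space_axioms add scale by blast
  then have "?P \<phi>" using prec succ gen by blast
  moreover have "\<psi> = \<phi>" if "?P \<psi>" for \<psi>
  proof
    fix u
    interpret L: Vector_Spaces.linear DD_scale scale \<psi> using that by blast
    have word: "\<psi> (abs_DD (Poly_Mapping.single s 1)) = A.word_val h s" for s
    proof (induction s)
      case (Gen x)
      then show ?case using that by (simp add: DD_gen_def)
    next
      case (Prec s t)
      have "abs_DD (Poly_Mapping.single (Prec s t) 1) =
          DD_prec (abs_DD (Poly_Mapping.single s 1)) (abs_DD (Poly_Mapping.single t 1 :: _ \<Rightarrow>\<^sub>0 'k))"
        by (simp add: DD_prec.abs_eq bilin_single)
      then show ?case using that Prec by simp
    next
      case (Succ s t)
      have "abs_DD (Poly_Mapping.single (Succ s t) 1) =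
          DD_succ (abs_DD (Poly_Mapping.single s 1)) (abs_DD (Poly_Mapping.single t 1 :: _ \<Rightarrow>\<^sub>0 'k))"
        by (simp add: DD_succ.abs_eq bilin_single)
      then show ?case using that Succ by simp
    qed
    have "\<psi> (abs_DD f) = A.word_ext h f" for f
    proof (induction f rule: Poly_Mapping.update_induct)
      case const
      then show ?case
        using L.zero by (simp add: zero_DD_def A.word_ext_def)
    next
      case (update f a b)
      have eq: "Poly_Mapping.update a b f = f + smult b (Poly_Mapping.single a 1)"
        using update(1)
        by (intro poly_mapping_eqI)
           (auto simp: Poly_Mapping.lookup_update lookup_add lookup_single when_def in_keys_iff)
      show ?case
        unfolding eq plus_DD.abs_eq[symmetric] DD_scale.abs_eq[symmetric] L.add L.scale update word
        by (simp add: A.word_ext_add A.word_ext_smult A.word_ext_single)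
    qed
    then show "\<psi> u = \<phi> u"
      by (induction u rule: DD.abs_induct) (simp add: \<phi>)
  qed
  ultimately show ?thesis by (rule ex1I)
qed

end

theory Submission
  imports Defs "HOL-Library.Function_Algebras" "HOL-Real_Asymp.Real_Asymp"
begin

text \<open>Functions on words over \<open>\<nat>\<close> form an associative algebra under concatenation (convolution).
  Splitting the product according to whether the maximal letter of a concatenation \<open>uv\<close> lies in
  \<open>u\<close> or only in \<open>v\<close> turns it into a dendriform algebra, over every field. Let \<open>x\<close> be the indicator
  of the one-letter words. The \<open>2\<^sup>d\<close> monomials obtained from \<open>x\<close> by \<open>d\<close> steps \<open>u \<mapsto> u \<succ> x\<close> or
  \<open>u \<mapsto> x \<prec> u\<close> are separated by the permutations that record, from the largest letter downwards,
  whether it stands at the end or at the beginning. By the universal property \<open>dim V\<^sub>(\<^sub>d\<^sub>)\<close> is at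
  least \<open>2\<^sup>d\<^sup>-\<^sup>1\<close>.\<close>

section \<open>Deconcatenation of words and restricted convolution products\<close>

definition splits :: "'a list \<Rightarrow> ('a list \<times> 'a list) set" where
  "splits w = {(u, v). u @ v = w}"

lemma splits_Nil: "splits [] = {([], [])}"
  by (auto simp: splits_def)

lemma splits_Cons: "splits (a # w) = insert ([], a # w) ((\<lambda>(u, v). (a # u, v)) ` splits w)"
  by (force simp: splits_def Cons_eq_append_conv append_eq_Cons_conv)

lemma finite_splits [simp]: "finite (splits w)"
  by (induction w) (auto simp: splits_Nil splits_Cons)

text \<open>Both sides enumerate the factorizations of \<open>w\<close> into three words;
  associativity of \<open>@\<close> matches the two index sets.\<close>

lemma sum_splits_assoc:
  fixes F :: "'a list \<Rightarrow> 'a list \<Rightarrow> 'a list \<Rightarrow> 'b::comm_monoid_add"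
  shows "(\<Sum>(r, t)\<in>splits w. \<Sum>(u, v)\<in>splits r. F u v t) =
    (\<Sum>(u, r)\<in>splits w. \<Sum>(v, t)\<in>splits r. F u v t)"
proof -
  have "(\<Sum>(r, t)\<in>splits w. \<Sum>(u, v)\<in>splits r. F u v t) =
      (\<Sum>((r, t), (u, v))\<in>(SIGMA p:splits w. splits (fst p)). F u v t)"
    by (simp add: sum.Sigma case_prod_unfold)
  also have "\<dots> = (\<Sum>((u, r), (v, t))\<in>(SIGMA p:splits w. splits (snd p)). F u v t)"
    by (rule sum.reindex_bij_witness
        [where i = "\<lambda>((u, r), (v, t)). ((u @ v, t), (u, v))"
           and j = "\<lambda>((r, t), (u, v)). ((u, v @ t), (v, t))"])
       (auto simp: splits_def)
  also have "\<dots> = (\<Sum>(u, r)\<in>splits w. \<Sum>(v, t)\<in>splits r. F u v t)"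
    by (simp add: sum.Sigma case_prod_unfold)
  finally show ?thesis .
qed

definition conv :: "('a list \<Rightarrow> 'a list \<Rightarrow> bool) \<Rightarrow> ('a list \<Rightarrow> 'k::field) \<Rightarrow> ('a list \<Rightarrow> 'k) \<Rightarrow> 'a list \<Rightarrow> 'k"
  where "conv P f g w = (\<Sum>(u, v)\<in>splits w. of_bool (P u v) * (f u * g v))"

text \<open>Here and in \<open>conv_conv_right\<close>, double products are brought to one common
  index set. Comparing them then amounts to comparing Boolean conditions on \<open>u\<close>,
  \<open>v\<close>, \<open>t\<close>.\<close>

lemma conv_conv_left:
  "conv Q (conv P f g) h w = (\<Sum>(u, r)\<in>splits w. \<Sum>(v, t)\<in>splits r.
    of_bool (P u v \<and> Q (u @ v) t) * (f u * g v * h t))"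
proof -
  have "conv Q (conv P f g) h w = (\<Sum>(r, t)\<in>splits w. \<Sum>(u, v)\<in>splits r.
      of_bool (P u v \<and> Q (u @ v) t) * (f u * g v * h t))"
    unfolding conv_def
    by (intro sum.cong refl)
       (auto simp: sum_distrib_left sum_distrib_right splits_def intro!: sum.cong)
  then show ?thesis
    by (simp only: sum_splits_assoc[where F = "\<lambda>u v t. of_bool (P u v \<and> Q (u @ v) t) * (f u * g v * h t)"])
qed

lemma conv_conv_right:
  "conv P f (conv Q g h) w = (\<Sum>(u, r)\<in>splits w. \<Sum>(v, t)\<in>splits r.
    of_bool (Q v t \<and> P u (v @ t)) * (f u * g v * h t))"
  unfolding conv_def
  by (intro sum.cong refl)
     (auto simp: sum_distrib_left splits_def intro!: sum.cong)

lemma conv_add_left: "conv P (f + g) h = conv P f h + conv P g h"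
  by (rule ext) (simp add: conv_def sum.distrib[symmetric] case_prod_unfold algebra_simps)

lemma conv_add_right: "conv P h (f + g) = conv P h f + conv P h g"
  by (rule ext) (simp add: conv_def sum.distrib[symmetric] case_prod_unfold algebra_simps)

lemma conv_scale_left: "conv P (\<lambda>w. c * f w) g = (\<lambda>w. c * conv P f g w)"
  by (rule ext) (simp add: conv_def sum_distrib_left case_prod_unfold algebra_simps)

lemma conv_scale_right: "conv P f (\<lambda>w. c * g w) = (\<lambda>w. c * conv P f g w)"
  by (rule ext) (simp add: conv_def sum_distrib_left case_prod_unfold algebra_simps)

section \<open>The dendriform structure given by maximal letters\<close>

definition max_letter :: "nat list \<Rightarrow> nat" where
  "max_letter w = foldr max w 0"

lemma max_letter_Nil [simp]: "max_letter [] = 0"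
  and max_letter_Cons [simp]: "max_letter (a # w) = max a (max_letter w)"
  by (simp_all add: max_letter_def)

text \<open>The value 0 of the empty word is neutral for \<open>max\<close> on the naturals, so the
  rule covers empty words as well.\<close>

lemma max_letter_append [simp]: "max_letter (u @ v) = max (max_letter u) (max_letter v)"
  by (induction u) (auto simp: max.assoc)

definition wprec :: "(nat list \<Rightarrow> 'k::field) \<Rightarrow> (nat list \<Rightarrow> 'k) \<Rightarrow> nat list \<Rightarrow> 'k" where
  "wprec = conv (\<lambda>u v. max_letter v \<le> max_letter u)"

definition wsucc :: "(nat list \<Rightarrow> 'k::field) \<Rightarrow> (nat list \<Rightarrow> 'k) \<Rightarrow> nat list \<Rightarrow> 'k" where
  "wsucc = conv (\<lambda>u v. max_letter u < max_letter v)"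

text \<open>On a factorization into \<open>u\<close>, \<open>v\<close>, \<open>t\<close>, both sides
  of the first axiom require the maximum of \<open>v\<close> to exceed that of \<open>u\<close> and
  to be at least that of \<open>t\<close>. In the other two axioms the two summands are the
  complementary cases \<open><\<close> and \<open>\<le>\<close> of one comparison.\<close>

lemma dendriform_words:
  "dendriform_algebra (\<lambda>(c::'k::field) f w. c * f w) wprec wsucc"
proof unfold_locales
  fix f g h :: "nat list \<Rightarrow> 'k"
  show "wprec (wsucc f g) h = wsucc f (wprec g h)"
    unfolding wprec_def wsucc_def
    by (rule ext, unfold conv_conv_left conv_conv_right)
       (auto intro!: sum.cong simp: of_bool_def)
  show "wprec (wprec f g) h = wprec f (wprec g h) + wprec f (wsucc g h)"
    unfolding wprec_def wsucc_def
    by (rule ext, unfold conv_conv_left conv_conv_right plus_fun_apply sum.distrib[symmetric])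
       (auto intro!: sum.cong simp: of_bool_def sum.distrib[symmetric] case_prod_unfold)
  show "wsucc f (wsucc g h) = wsucc (wsucc f g) h + wsucc (wprec f g) h"
    unfolding wprec_def wsucc_def
    by (rule ext, unfold conv_conv_left conv_conv_right plus_fun_apply sum.distrib[symmetric])
       (auto intro!: sum.cong simp: of_bool_def sum.distrib[symmetric] case_prod_unfold)
qed (simp_all add: wprec_def wsucc_def conv_add_left conv_add_right conv_scale_left
    conv_scale_right fun_eq_iff algebra_simps)

section \<open>Combs and the permutations that separate them\<close>

context dendriform_algebra
begin

primrec comb :: "'a \<Rightarrow> bool list \<Rightarrow> 'a" where
  "comb x [] = x"
| "comb x (b # p) = (if b then comb x p \<succ> x else x \<prec> comb x p)"

lemma monomial_comb:
  assumes "x \<in> G"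
  shows "monomial G (Suc (length p)) (comb x p)"
proof (induction p)
  case Nil
  then show ?case using monomial.gen[OF assms] by simp
next
  case (Cons b p)
  then show ?case
    using monomial.prec[OF monomial.gen[OF assms] Cons] monomial.succ[OF Cons monomial.gen[OF assms]]
    by simp
qed

end

interpretation W: dendriform_algebra "\<lambda>(c::'k::field) f w. c * f w" wprec wsucc
  by (rule dendriform_words)

definition letter :: "nat list \<Rightarrow> 'k::field" where
  "letter w = of_bool (length w = 1)"

text \<open>Follows the recursion of \<open>comb\<close>: the letter belonging to the outermost
  factor exceeds all others, so the condition of the product chosen there is met.\<close>

primrec comb_perm :: "bool list \<Rightarrow> nat list" where
  "comb_perm [] = [0]"
| "comb_perm (b # p) =
    (if b then comb_perm p @ [Suc (length p)] else Suc (length p) # comb_perm p)"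

lemma max_letter_comb_perm [simp]: "max_letter (comb_perm p) = length p"
  by (induction p) auto

lemma comb_perm_nonempty [simp]: "comb_perm p \<noteq> []"
  by (cases p) auto

text \<open>Since \<open>letter\<close> vanishes off words of length 1, only the split before the
  last letter contributes.\<close>

lemma wsucc_letter_snoc:
  "wsucc f letter (w @ [a]) = of_bool (max_letter w < a) * f w"
proof -
  have "wsucc f letter (w @ [a]) = (\<Sum>(u, v)\<in>{(w, [a])}. of_bool (max_letter u < max_letter v) * (f u * letter v))"
    unfolding wsucc_def conv_def
    by (rule sum.mono_neutral_right[OF finite_splits])
       (auto simp: splits_def letter_def length_Suc_conv append_eq_append_conv2 append_eq_Cons_conv)
  then show ?thesis by (simp add: letter_def)
qed

lemma wprec_letter_Cons:
  "wprec letter f (a # w) = of_bool (max_letter w \<le> a) * f w"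
proof -
  have "wprec letter f (a # w) = (\<Sum>(u, v)\<in>{([a], w)}. of_bool (max_letter v \<le> max_letter u) * (letter u * f v))"
    unfolding wprec_def conv_def
    by (rule sum.mono_neutral_right[OF finite_splits])
       (auto simp: splits_def letter_def length_Suc_conv append_eq_append_conv2 append_eq_Cons_conv)
  then show ?thesis by (simp add: letter_def)
qed

text \<open>Induction peels off the outermost factor. Equal choices strip the largest letter and
  reduce to the tails; unequal choices give 0.\<close>

lemma comb_letter_comb_perm:
  assumes "length p = length q"
  shows "(W.comb letter p :: nat list \<Rightarrow> 'k::field) (comb_perm q) = of_bool (p = q)"
  using assms
proof (induction p q rule: list_induct2)
  case Nil
  then show ?case by (simp add: letter_def)
next
  case (Cons b p c q)
  let ?f = "W.comb letter p :: nat list \<Rightarrow> 'k" and ?m = "Suc (length q)"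
  \<comment> \<open>The only candidate split leaves the maximum \<open>?m\<close> in the left
    factor, which \<open>wsucc\<close> excludes.\<close>
  have "wsucc ?f letter (?m # comb_perm q) = 0"
  proof -
    obtain u a where ua: "comb_perm q = u @ [a]"
      using comb_perm_nonempty[of q] by (cases "comb_perm q" rule: rev_cases) auto
    have "a \<le> length q" using max_letter_comb_perm[of q] ua by simp
    then show ?thesis using wsucc_letter_snoc[of ?f "?m # u" a] ua by simp
  qed
  \<comment> \<open>Mirror case: \<open>?m\<close> falls into the right factor, which
    \<open>wprec\<close> excludes.\<close>
  moreover have "wprec letter ?f (comb_perm q @ [?m]) = 0"
  proof -
    obtain u a where ua: "comb_perm q = a # u"
      using comb_perm_nonempty[of q] by (cases "comb_perm q") auto
    have "a \<le> length q" using max_letter_comb_perm[of q] ua by simp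
    then show ?thesis using wprec_letter_Cons[of ?f a "u @ [?m]"] ua by simp
  qed
  ultimately show ?case
    using Cons.IH by (simp add: wsucc_letter_snoc wprec_letter_Cons)
qed

section \<open>Dual families and dimension estimates\<close>

context vector_space
begin

text \<open>Applying \<open>f i\<close> to a vanishing combination isolates the coefficient of
  \<open>e i\<close>.\<close>

lemma biorthogonal_independent:
  assumes "finite I"
    and lin: "\<And>i. i \<in> I \<Longrightarrow> Vector_Spaces.linear scale (*) (f i)"
    and dual: "\<And>i j. i \<in> I \<Longrightarrow> j \<in> I \<Longrightarrow> f i (e j) = of_bool (j = i)"
  shows "inj_on e I" and "independent (e ` I)"
proof -
  show inj: "inj_on e I"
    using dual by (intro inj_onI) (metis of_bool_eq_iff)
  have "c (e i) = 0" if "(\<Sum>v\<in>e ` I. scale (c v) v) = 0" and i: "i \<in> I" for c i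
  proof -
    interpret L: Vector_Spaces.linear scale "(*)" "f i" by (rule lin[OF i])
    have "0 = f i (\<Sum>j\<in>I. scale (c (e j)) (e j))"
      using that(1) L.zero by (simp add: sum.reindex[OF inj])
    also have "\<dots> = (\<Sum>j\<in>I. c (e j) * of_bool (j = i))"
      by (simp add: L.sum L.scale dual i)
    also have "\<dots> = c (e i)"
      using i \<open>finite I\<close> by (simp add: of_bool_def if_distrib[of "(*) _"] cong: if_cong)
    finally show ?thesis by simp
  qed
  then show "independent (e ` I)"
    using \<open>finite I\<close> by (subst dependent_finite) auto
qed

text \<open>The ambient space may be infinite-dimensional; finiteness of a basis of
  \<open>span S\<close> comes from \<open>S\<close>.\<close>

lemma card_le_dim_span:
  assumes "finite S" "independent B" "B \<subseteq> span S"
  shows "card B \<le> dim (span S)"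
proof -
  obtain C where C: "C \<subseteq> span S" "independent C" "span S \<subseteq> span C" "card C = dim (span S)"
    using basis_exists[of "span S"] by blast
  have "finite C" using independent_span_bound[OF assms(1) C(2,1)] by simp
  then show ?thesis
    using independent_span_bound[of C B] assms(2,3) C(3,4) by auto
qed

end

text \<open>Combs in a single generator already give the bound. The index is \<open>Suc d\<close>
  because \<open>d\<close> steps add \<open>d\<close> factors to the initial one.\<close>

lemma dim_V_DD_ge:
  "2 ^ d \<le> DD.dim (DD.V (range (DD_gen :: 'x::finite \<Rightarrow> ('x, 'k::field) DD)) (Suc d))"
proof -
  obtain \<phi> :: "('x, 'k) DD \<Rightarrow> nat list \<Rightarrow> 'k"
    where lin: "Vector_Spaces.linear DD_scale (\<lambda>c f w. c * f w) \<phi>"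
      and prec: "\<And>u v. \<phi> (DD_prec u v) = wprec (\<phi> u) (\<phi> v)"
      and succ: "\<And>u v. \<phi> (DD_succ u v) = wsucc (\<phi> u) (\<phi> v)"
      and gen: "\<And>x. \<phi> (DD_gen x) = letter"
    using ex1_implies_ex[OF DD_universal[OF dendriform_words, of "\<lambda>_. letter"]] by blast
  interpret L: Vector_Spaces.linear DD_scale "\<lambda>c f w. c * f w" \<phi> by (rule lin)
  \<comment> \<open>\<open>undefined\<close> stands for an arbitrary element of
    \<open>'x\<close>.\<close>
  define e where "e p = DD.comb (DD_gen undefined :: ('x, 'k) DD) p" for p
  have \<phi>_e: "\<phi> (e p) = W.comb letter p" for p
    unfolding e_def by (induction p) (simp_all add: prec succ gen)
  define I where "I = {p :: bool list. length p = d}"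
  have card_I: "card I = 2 ^ d" and fin_I: "finite I"
    using card_lists_length_eq[of "UNIV :: bool set" d] finite_lists_length_eq[of "UNIV :: bool set" d]
    by (simp_all add: I_def)
  have vs: "vector_space ((*) :: 'k \<Rightarrow> 'k \<Rightarrow> 'k)"
    by unfold_locales (simp_all add: algebra_simps)
  \<comment> \<open>Evaluation of \<open>\<phi>\<close> at \<open>comb_perm q\<close> is the
    functional dual to \<open>e q\<close>.\<close>
  have "Vector_Spaces.linear DD_scale (*) (\<lambda>u. \<phi> u (comb_perm q))" for q
    unfolding Vector_Spaces.linear_iff
    using DD.vector_space_axioms vs by (simp add: L.add L.scale)
  moreover have "\<phi> (e p) (comb_perm q) = of_bool (p = q)" if "q \<in> I" "p \<in> I" for p q
    using that comb_letter_comb_perm[of p q] by (simp add: \<phi>_e I_def)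
  ultimately have inj: "inj_on e I" and ind: "DD.independent (e ` I)"
    using DD.biorthogonal_independent[OF fin_I, of "\<lambda>q u. \<phi> u (comb_perm q)" e] by blast+
  let ?G = "range (DD_gen :: 'x \<Rightarrow> ('x, 'k) DD)"
  let ?M = "{u. \<exists>i\<le>Suc d. DD.monomial ?G i u}"
  have "e ` I \<subseteq> ?M"
    using DD.monomial_comb[of "DD_gen undefined" ?G] by (force simp: e_def I_def)
  then have "e ` I \<subseteq> DD.span ?M"
    using DD.span_superset by blast
  then have "card (e ` I) \<le> DD.dim (DD.span ?M)"
    by (intro DD.card_le_dim_span DD.finite_monomials ind) simp_all
  then show ?thesis
    by (simp add: card_image[OF inj] card_I DD.V_def)
qed

theorem theorem4p7:
  shows "DD.GK_dim (range (DD_gen :: 'x::finite \<Rightarrow> ('x, 'k::field) DD)) = \<infinity>"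
proof -
  let ?D = "\<lambda>d. DD.dim (DD.V (range (DD_gen :: 'x \<Rightarrow> ('x, 'k) DD)) d)"
  \<comment> \<open>The bound \<open>2 ^ (d - 1)\<close> makes the quotient grow at least like
    \<open>d / ln d\<close>.\<close>
  have "eventually (\<lambda>d. (real d - 1) * ln 2 / ln (real d) \<le> ln (real (?D d)) / ln (real d)) sequentially"
    \<comment> \<open>From 2 on, \<open>ln d\<close> is positive, so dividing by it keeps the
      inequality.\<close>
    using eventually_ge_at_top[of 2]
  proof eventually_elim
    case (elim d)
    then obtain m where m: "d = Suc m" by (cases d) auto
    have "(2::real) ^ m \<le> real (?D d)"
      using dim_V_DD_ge[of m, where 'x = 'x and 'k = 'k] unfolding m
      by (metis of_nat_le_iff of_nat_numeral of_nat_power)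
    moreover have "(0::real) < 2 ^ m" by simp
    ultimately have "ln (2 ^ m) \<le> ln (real (?D d))"
      by (subst ln_le_cancel_iff) linarith+
    then show ?case
      using elim by (intro divide_right_mono) (simp_all add: m ln_realpow)
  qed
  moreover have "filterlim (\<lambda>d. (real d - 1) * ln 2 / ln (real d)) at_top sequentially"
    by real_asymp
  ultimately have "filterlim (\<lambda>d. ln (real (?D d)) / ln (real d)) at_top sequentially"
    by (rule filterlim_at_top_mono[rotated])
  then have "(\<lambda>d. ereal (ln (real (?D d)) / ln (real d))) \<longlonglongrightarrow> \<infinity>"
    by (simp add: tendsto_PInfty_eq_at_top)
  then show ?thesis
    unfolding DD.GK_dim_def by (intro lim_imp_Limsup) simp_all
qed

end
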